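(* Let $\mathrm{C}(\varepsilon_s)$ denote the capacity (in nats) of the noiseless discrete-time Poisson channel at average signal energy $\varepsilon_s>0$. Then, as $\varepsilon_s\to 0^+$, $$\mathrm{C}(\varepsilon_s) = -\varepsilon_s\log\varepsilon_s + o(-\varepsilon_s\log\varepsilon_s).$$
   Context: Logarithms are natural. The noiseless discrete-time Poisson channel at average signal energy $\varepsilon_s>0$ is the memoryless channel whose input $X$ is a non-negative real random variable and whose output $Y$ is a non-negative integer which, conditionally on $X=x$, has a Poisson distribution of parameter $\varepsilon_s x$, i.e. $Q(y|x)=e^{-\varepsilon_s x}\frac{(\varepsilon_s x)^y}{y!}$ for $y=0,1,2,\dots$ (for $x=0$ the output is $0$ with probability one). The capacity $\mathrm{C}(\varepsilon_s)$ is the supremum of the mutual information $I(X;Y)$ (in nats) over all probability distributions of $X$ on $[0,\infty)$ with $\mathbb{E}[X]\le 1$. *)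

theory Defs
  imports "HOL-Probability.Probability" "HOL-Library.Landau_Symbols"
begin

text \<open>
  \<open>poisson_pmf\<close> is only specified for positive rates; input \<open>0\<close> yields output \<open>0\<close> almost surely.
  Negative inputs never occur, since input laws are concentrated on the non-negative reals.
\<close>

definition poisson_channel :: "real \<Rightarrow> real \<Rightarrow> nat pmf" where
  "poisson_channel \<epsilon> x = (if x > 0 then poisson_pmf (\<epsilon> * x) else return_pmf 0)"

lemma pmf_poisson_channel:
  assumes "\<epsilon> > 0" "x \<ge> 0"
  shows "pmf (poisson_channel \<epsilon> x) y = exp (- \<epsilon> * x) * (\<epsilon> * x) ^ y / fact y"
  using assms by (cases "x = 0"; cases y) (auto simp: poisson_channel_def)

text \<open>
  The expectation constraint uses the non-negative integral, so inputs with infinite mean are excluded.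
\<close>

definition poisson_inputs :: "real measure set" where
  "poisson_inputs = {P. prob_space P \<and> sets P = sets borel \<and> (AE x in P. 0 \<le> x) \<and>
     (\<integral>\<^sup>+ x. ennreal x \<partial>P) \<le> 1}"

text \<open>Joint law of \<open>(X, Y)\<close> when \<open>X\<close> has law \<open>P\<close> and \<open>Y\<close> given \<open>X = x\<close> has law \<open>poisson_channel \<epsilon> x\<close>.\<close>

definition poisson_joint :: "real \<Rightarrow> real measure \<Rightarrow> (real \<times> nat) measure" where
  "poisson_joint \<epsilon> P =
     density (P \<Otimes>\<^sub>M count_space UNIV) (\<lambda>(x, y). ennreal (pmf (poisson_channel \<epsilon> x) y))"

lemma measurable_pmf_poisson_channel:
  assumes "\<epsilon> > 0" "sets P = sets borel"
  shows "(\<lambda>(x, y). ennreal (pmf (poisson_channel \<epsilon> x) y))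
           \<in> borel_measurable (P \<Otimes>\<^sub>M count_space UNIV)"
proof -
  note [measurable_cong] = assms(2)
  have eq: "(\<lambda>x. ennreal (pmf (poisson_channel \<epsilon> x) y)) =
      (\<lambda>x. ennreal (if x > 0 then (\<epsilon> * x) ^ y / fact y * exp (- (\<epsilon> * x)) else indicator {0} y))" for y
    using assms by (auto simp: poisson_channel_def fun_eq_iff indicator_def)
  have "(\<lambda>x. ennreal (pmf (poisson_channel \<epsilon> x) y)) \<in> borel_measurable P" for y
    unfolding eq by measurable
  then have [measurable]: "(\<lambda>p. ennreal (pmf (poisson_channel \<epsilon> (fst p)) y))
      \<in> borel_measurable (P \<Otimes>\<^sub>M count_space UNIV)" for y
    by (rule measurable_compose[OF measurable_fst])
  have "(\<lambda>p. ennreal (pmf (poisson_channel \<epsilon> (fst p)) (snd p)))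
           \<in> borel_measurable (P \<Otimes>\<^sub>M count_space UNIV)"
    by (rule measurable_compose_countable'[where I = UNIV and g = snd and
          f = "\<lambda>y p. ennreal (pmf (poisson_channel \<epsilon> (fst p)) y)"]) measurable
  then show ?thesis
    by (simp add: split_beta')
qed

lemma emeasure_poisson_joint:
  assumes "\<epsilon> > 0" "prob_space P" "sets P = sets borel" "A \<in> sets borel"
  shows "emeasure (poisson_joint \<epsilon> P) (A \<times> B) =
    (\<integral>\<^sup>+ x. emeasure (measure_pmf (poisson_channel \<epsilon> x)) B * indicator A x \<partial>P)"
proof -
  interpret P: prob_space P by fact
  interpret C: sigma_finite_measure "count_space (UNIV :: nat set)"
    by (rule sigma_finite_measure_count_space)
  note [measurable] = measurable_pmf_poisson_channel[OF assms(1,3)]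
  have [measurable]: "A \<in> sets P" using assms by simp
  have "emeasure (poisson_joint \<epsilon> P) (A \<times> B) =
     (\<integral>\<^sup>+ x. \<integral>\<^sup>+ y. ennreal (pmf (poisson_channel \<epsilon> x) y) * indicator (A \<times> B) (x, y)
        \<partial>count_space UNIV \<partial>P)"
    unfolding poisson_joint_def
    by (subst emeasure_density, measurable, subst C.nn_integral_fst[symmetric])
       (auto simp: split_beta')
  also have "\<dots> = (\<integral>\<^sup>+ x. (\<integral>\<^sup>+ y. ennreal (pmf (poisson_channel \<epsilon> x) y) * indicator B y
        \<partial>count_space UNIV) * indicator A x \<partial>P)"
    by (intro nn_integral_cong) (auto simp: indicator_def)
  also have "\<dots> = (\<integral>\<^sup>+ x. emeasure (measure_pmf (poisson_channel \<epsilon> x)) B * indicator A x \<partial>P)"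
    by (simp flip: nn_integral_measure_pmf)
  finally show ?thesis .
qed

lemma prob_space_poisson_joint:
  assumes "\<epsilon> > 0" "prob_space P" "sets P = sets borel"
  shows "prob_space (poisson_joint \<epsilon> P)"
proof
  interpret P: prob_space P by fact
  have "space P = UNIV" using sets_eq_imp_space_eq[OF assms(3)] by simp
  then have "space (poisson_joint \<epsilon> P) = UNIV \<times> UNIV"
    by (simp add: poisson_joint_def space_pair_measure)
  then show "emeasure (poisson_joint \<epsilon> P) (space (poisson_joint \<epsilon> P)) = 1"
    using emeasure_poisson_joint[OF assms, of UNIV UNIV] measure_pmf.emeasure_space_1 P.emeasure_space_1
    by simp
qed

text \<open>
  \<open>mutual_information\<close> is a Bochner integral, which would be \<open>0\<close> for an infinite mutual information.
  This does not occur here: the output has mean at most \<open>\<epsilon>\<close>, so its entropy is finite and bounds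
  the mutual information. The logarithm base \<open>exp 1\<close> gives nats.
\<close>

definition poisson_mutual_information :: "real \<Rightarrow> real measure \<Rightarrow> real" where
  "poisson_mutual_information \<epsilon> P =
     prob_space.mutual_information (poisson_joint \<epsilon> P) (exp 1) borel (count_space UNIV) fst snd"

definition poisson_capacity :: "real \<Rightarrow> ereal" where
  "poisson_capacity \<epsilon> = (SUP P\<in>poisson_inputs. ereal (poisson_mutual_information \<epsilon> P))"

end

(*
Upper bound: I(X;Y) \<le> H(Y), and among outputs of mean at most \<epsilon> the entropy is at most that of the
geometric law G of mean \<epsilon>, namely (1 + \<epsilon>) ln (1 + \<epsilon>) - \<epsilon> ln \<epsilon>. Both steps are done at once by the
pointwise estimate ln (W(y|x) / Q(y)) \<le> - ln G(y) + G(y) / Q(y) - 1, with Q the output law.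

Lower bound: on-off keying, X = 1/p with probability p and X = 0 otherwise. A positive output reveals
that X is on and contributes - ln p; the cost of the output 0 is at most p * (\<epsilon> / p) = \<epsilon>. The choice
p = - \<epsilon> ln \<epsilon> makes both p and the energy \<epsilon> / p = 1 / (- ln \<epsilon>) of a pulse tend to 0.
*)

theory Submission
  imports Defs "HOL-Real_Asymp.Real_Asymp"
begin

section \<open>Marginals of the joint law\<close>

definition output_prob :: "real \<Rightarrow> real measure \<Rightarrow> nat \<Rightarrow> real" where
  "output_prob \<epsilon> P y = measure (poisson_joint \<epsilon> P) (UNIV \<times> {y})"

lemma sets_poisson_joint:
  assumes "sets P = sets borel"
  shows "sets (poisson_joint \<epsilon> P) = sets (borel \<Otimes>\<^sub>M count_space UNIV)"
  unfolding poisson_joint_def using sets_pair_measure_cong[OF assms refl] by simp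

text \<open>Every channel law has total mass 1, so summing out the output returns the input law. The
  target is \<open>P\<close> rather than \<open>borel\<close> because \<open>P\<close> later serves
  as the reference measure for the input.\<close>

lemma distr_fst_poisson_joint:
  assumes "\<epsilon> > 0" "prob_space P" "sets P = sets borel"
  shows "distr (poisson_joint \<epsilon> P) P fst = P"
proof (rule measure_eqI)
  have sp: "space (poisson_joint \<epsilon> P) = UNIV"
    using sets_eq_imp_space_eq[OF sets_poisson_joint[OF assms(3), of \<epsilon>]]
    by (simp add: space_pair_measure)
  fix A assume "A \<in> sets (distr (poisson_joint \<epsilon> P) P fst)"
  then have A: "A \<in> sets borel" using assms(3) by simp
  have [measurable]: "fst \<in> poisson_joint \<epsilon> P \<rightarrow>\<^sub>M P"
    using assms(3) sets_poisson_joint[OF assms(3), of \<epsilon>]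
    by (metis measurable_cong_sets measurable_fst)
  have "emeasure (distr (poisson_joint \<epsilon> P) P fst) A = emeasure (poisson_joint \<epsilon> P) (A \<times> UNIV)"
    using A assms(3) sp by (subst emeasure_distr) (auto intro!: arg_cong[where f = "emeasure _"])
  also have "\<dots> = emeasure P A"
    using A assms measure_pmf.emeasure_space_1 by (subst emeasure_poisson_joint) auto
  finally show "emeasure (distr (poisson_joint \<epsilon> P) P fst) A = emeasure P A" .
qed simp

lemma distr_snd_poisson_joint:
  assumes "\<epsilon> > 0" "prob_space P" "sets P = sets borel"
  shows "distr (poisson_joint \<epsilon> P) (count_space UNIV) snd =
    density (count_space UNIV) (\<lambda>y. ennreal (output_prob \<epsilon> P y))"
proof (rule measure_eqI_countable[where A = UNIV])
  interpret J: prob_space "poisson_joint \<epsilon> P"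
    by (rule prob_space_poisson_joint[OF assms])
  have sp: "space (poisson_joint \<epsilon> P) = UNIV"
    using sets_eq_imp_space_eq[OF sets_poisson_joint[OF assms(3), of \<epsilon>]]
    by (simp add: space_pair_measure)
  have [measurable]: "snd \<in> poisson_joint \<epsilon> P \<rightarrow>\<^sub>M count_space UNIV"
    using sets_poisson_joint[OF assms(3), of \<epsilon>]
    by (metis measurable_cong_sets measurable_snd)
  fix y :: nat
  have "emeasure (distr (poisson_joint \<epsilon> P) (count_space UNIV) snd) {y} =
      emeasure (poisson_joint \<epsilon> P) (UNIV \<times> {y})"
    using sp by (subst emeasure_distr) (auto intro!: arg_cong[where f = "emeasure _"])
  also have "\<dots> = ennreal (output_prob \<epsilon> P y)"
    by (simp add: output_prob_def J.emeasure_eq_measure)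
  finally show "emeasure (distr (poisson_joint \<epsilon> P) (count_space UNIV) snd) {y} =
      emeasure (density (count_space UNIV) (\<lambda>y. ennreal (output_prob \<epsilon> P y))) {y}"
    by (subst emeasure_density) (auto simp: nn_integral_count_space_indicator[symmetric])
qed auto

section \<open>Mutual information as an expected log-likelihood ratio\<close>

lemma borel_measurable_pmf_poisson_channel:
  assumes "\<epsilon> > 0" "sets P = sets borel"
  shows "(\<lambda>z. pmf (poisson_channel \<epsilon> (fst z)) (snd z))
    \<in> borel_measurable (P \<Otimes>\<^sub>M count_space UNIV)"
proof -
  have "(\<lambda>z. enn2real (case z of (x, y) \<Rightarrow> ennreal (pmf (poisson_channel \<epsilon> x) y)))
      \<in> borel_measurable (P \<Otimes>\<^sub>M count_space UNIV)"
    using measurable_pmf_poisson_channel[OF assms] by measurable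
  then show ?thesis by (simp add: split_beta')
qed

text \<open>Relative to \<open>P\<close> times counting measure, the input, the output and the pair
  have densities 1, \<open>output_prob\<close> and the channel probability. Taking \<open>P\<close>
  itself as reference treats discrete and continuous inputs alike. Both sides are Bochner integrals,
  so they are both 0 if the log ratio is not integrable.\<close>

lemma poisson_mutual_information_eq_integral:
  assumes "\<epsilon> > 0" "prob_space P" "sets P = sets borel"
  shows "poisson_mutual_information \<epsilon> P =
    (\<integral>z. ln (pmf (poisson_channel \<epsilon> (fst z)) (snd z) / output_prob \<epsilon> P (snd z))
      \<partial>poisson_joint \<epsilon> P)"
proof -
  let ?J = "poisson_joint \<epsilon> P" and ?W = "\<lambda>z. pmf (poisson_channel \<epsilon> (fst z)) (snd z)"
  interpret P: prob_space P by fact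
  interpret J: prob_space ?J
    by (rule prob_space_poisson_joint[OF assms])
  interpret J: information_space ?J "exp 1" by unfold_locales simp
  note borel_measurable_pmf_poisson_channel[OF assms(1,3), measurable]
  have J: "?J = density (P \<Otimes>\<^sub>M count_space UNIV) (\<lambda>z. ennreal (?W z))"
    by (simp add: poisson_joint_def split_beta')
  have sJ: "sets ?J = sets (P \<Otimes>\<^sub>M count_space UNIV)" by (simp add: J)
  have mfst: "fst \<in> ?J \<rightarrow>\<^sub>M P" and msnd: "snd \<in> ?J \<rightarrow>\<^sub>M count_space UNIV"
    unfolding measurable_cong_sets[OF sJ refl] by auto
  \<comment> \<open>\<open>distr\<close> looks only at the sigma-algebra of its target, so
    \<open>borel\<close> can be exchanged for \<open>P\<close>.\<close>
  have b: "distr ?J borel fst = distr ?J P fst"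
    by (rule distr_cong) (use assms(3) in auto)
  have b': "distr ?J (borel \<Otimes>\<^sub>M count_space UNIV) (\<lambda>z. (fst z, snd z)) =
      distr ?J (P \<Otimes>\<^sub>M count_space UNIV) (\<lambda>z. (fst z, snd z))"
    by (rule distr_cong) (use sets_pair_measure_cong[OF assms(3) refl] in auto)
  have "poisson_mutual_information \<epsilon> P = J.mutual_information (exp 1) P (count_space UNIV) fst snd"
    unfolding poisson_mutual_information_def J.mutual_information_def b b' ..
  also have "\<dots> = (\<integral>z. ?W z * log (exp 1) (?W z / (1 * output_prob \<epsilon> P (snd z)))
      \<partial>(P \<Otimes>\<^sub>M count_space UNIV))"
  proof (rule J.mutual_information_distr)
    show "sigma_finite_measure P" by unfold_locales
    show "sigma_finite_measure (count_space (UNIV :: nat set))"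
      by (rule sigma_finite_measure_count_space)
    show "distributed ?J P fst (\<lambda>x. ennreal 1)"
      using mfst distr_fst_poisson_joint[OF assms] by (simp add: distributed_def density_1)
    show "distributed ?J (count_space UNIV) snd (\<lambda>y. ennreal (output_prob \<epsilon> P y))"
      using msnd distr_snd_poisson_joint[OF assms] by (simp add: distributed_def)
    have "distr ?J (P \<Otimes>\<^sub>M count_space UNIV) (\<lambda>z. (fst z, snd z)) = ?J"
      using distr_id2[OF sJ[symmetric]] by (simp add: id_def)
    moreover have "(\<lambda>z. (fst z, snd z)) \<in> ?J \<rightarrow>\<^sub>M P \<Otimes>\<^sub>M count_space UNIV"
      unfolding measurable_cong_sets[OF sJ refl] by simp
    ultimately show "distributed ?J (P \<Otimes>\<^sub>M count_space UNIV) (\<lambda>z. (fst z, snd z)) (\<lambda>z. ennreal (?W z))"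
      by (simp add: distributed_def J)
  qed (auto simp: output_prob_def)
  \<comment> \<open>The weight \<open>?W\<close> is absorbed back into the joint law as its
    density.\<close>
  also have "\<dots> = (\<integral>z. ln (?W z / output_prob \<epsilon> P (snd z)) \<partial>?J)"
    unfolding J by (subst integral_real_density) (auto simp: log_def)
  finally show ?thesis .
qed

text \<open>A density is almost surely positive under the measure it defines; this is applied to the
  joint law and, pulled back along \<open>snd\<close>, to the output law. Up to a null set, the
  quotients and logarithms of these probabilities thus avoid their default values at 0.\<close>

lemma AE_poisson_joint_pos:
  assumes "\<epsilon> > 0" "prob_space P" "sets P = sets borel"
  shows "AE z in poisson_joint \<epsilon> P.
    0 < pmf (poisson_channel \<epsilon> (fst z)) (snd z) \<and> 0 < output_prob \<epsilon> P (snd z)"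
proof -
  let ?J = "poisson_joint \<epsilon> P" and ?W = "\<lambda>z. pmf (poisson_channel \<epsilon> (fst z)) (snd z)"
  note borel_measurable_pmf_poisson_channel[OF assms(1,3), measurable]
  have J: "?J = density (P \<Otimes>\<^sub>M count_space UNIV) (\<lambda>z. ennreal (?W z))"
    by (simp add: poisson_joint_def split_beta')
  have "AE z in ?J. 0 < ?W z"
    unfolding J by (subst AE_density) auto
  moreover have msnd: "snd \<in> ?J \<rightarrow>\<^sub>M count_space UNIV"
    unfolding J by simp
  have "AE y in density (count_space UNIV) (\<lambda>y. ennreal (output_prob \<epsilon> P y)).
      0 < output_prob \<epsilon> P y"
    by (subst AE_density) auto
  then have "AE y in distr ?J (count_space UNIV) snd. 0 < output_prob \<epsilon> P y"
    unfolding distr_snd_poisson_joint[OF assms] .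
  then have "AE z in ?J. 0 < output_prob \<epsilon> P (snd z)"
    by (rule AE_distrD[OF msnd])
  ultimately show ?thesis by eventually_elim auto
qed

section \<open>Upper bound: output mean and comparison with a geometric law\<close>

lemma nn_integral_poisson_channel:
  assumes "\<epsilon> > 0" "x \<ge> 0"
  shows "(\<integral>\<^sup>+ y. ennreal (pmf (poisson_channel \<epsilon> x) y) * ennreal (real y) \<partial>count_space UNIV) =
    ennreal (\<epsilon> * x)"
proof -
  let ?f = "\<lambda>y. pmf (poisson_channel \<epsilon> x) y * real y"
  have "(\<lambda>n. (\<epsilon> * x) ^ n /\<^sub>R fact n) sums exp (\<epsilon> * x)"
    by (rule exp_converges)
  \<comment> \<open>Cancelling the factor \<open>y\<close> against the factorial shifts the index by
    one and leaves the exponential series times \<open>\<epsilon> * x\<close>. The term at 0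
    vanishes, so the shift loses nothing.\<close>
  from sums_mult[OF this, of "exp (- \<epsilon> * x) * (\<epsilon> * x)"]
  have "(\<lambda>n. ?f (Suc n)) sums (\<epsilon> * x)"
    using assms
    by (simp add: pmf_poisson_channel field_simps exp_minus del: of_nat_Suc)
  then have s: "?f sums (\<epsilon> * x)"
    by (subst (asm) sums_Suc_iff) simp
  have "(\<integral>\<^sup>+ y. ennreal (pmf (poisson_channel \<epsilon> x) y) * ennreal (real y) \<partial>count_space UNIV) =
      (\<Sum>y. ennreal (?f y))"
    by (simp add: nn_integral_count_space_nat ennreal_mult)
  also have "\<dots> = ennreal (\<epsilon> * x)"
    using s by (intro suminf_ennreal_eq) auto
  finally show ?thesis .
qed

text \<open>By Tonelli, the mean output is the average of the conditional means
  \<open>\<epsilon> * x\<close>; the energy constraint then applies.\<close>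

lemma nn_integral_output_le:
  assumes "\<epsilon> > 0" "P \<in> poisson_inputs"
  shows "(\<integral>\<^sup>+ z. ennreal (real (snd z)) \<partial>poisson_joint \<epsilon> P) \<le> ennreal \<epsilon>"
proof -
  have P: "prob_space P" "sets P = sets borel" "AE x in P. 0 \<le> x" "(\<integral>\<^sup>+ x. ennreal x \<partial>P) \<le> 1"
    using assms(2) by (auto simp: poisson_inputs_def)
  note [measurable_cong] = P(2)
  interpret C: sigma_finite_measure "count_space (UNIV :: nat set)"
    by (rule sigma_finite_measure_count_space)
  note borel_measurable_pmf_poisson_channel[OF assms(1) P(2), measurable]
  have J: "poisson_joint \<epsilon> P = density (P \<Otimes>\<^sub>M count_space UNIV)
      (\<lambda>z. ennreal (pmf (poisson_channel \<epsilon> (fst z)) (snd z)))"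
    by (simp add: poisson_joint_def split_beta')
  have "(\<integral>\<^sup>+ z. ennreal (real (snd z)) \<partial>poisson_joint \<epsilon> P) =
      (\<integral>\<^sup>+ x. \<integral>\<^sup>+ y. ennreal (pmf (poisson_channel \<epsilon> x) y) * ennreal (real y)
        \<partial>count_space UNIV \<partial>P)"
    unfolding J by (subst nn_integral_density, measurable, subst C.nn_integral_fst[symmetric]) auto
  also have "\<dots> = (\<integral>\<^sup>+ x. ennreal \<epsilon> * ennreal x \<partial>P)"
    using P(3) assms(1)
    by (intro nn_integral_cong_AE) (auto simp: nn_integral_poisson_channel ennreal_mult)
  also have "\<dots> = ennreal \<epsilon> * (\<integral>\<^sup>+ x. ennreal x \<partial>P)"
    by (rule nn_integral_cmult) measurable
  also have "\<dots> \<le> ennreal \<epsilon> * 1"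
    by (intro mult_left_mono P) simp
  finally show ?thesis by simp
qed

lemma poisson_mutual_information_le:
  assumes "\<epsilon> > 0" "P \<in> poisson_inputs"
  shows "poisson_mutual_information \<epsilon> P \<le> (1 + \<epsilon>) * ln (1 + \<epsilon>) - \<epsilon> * ln \<epsilon>"
proof -
  have P: "prob_space P" "sets P = sets borel"
    using assms(2) by (auto simp: poisson_inputs_def)
  let ?J = "poisson_joint \<epsilon> P" and ?W = "\<lambda>z. pmf (poisson_channel \<epsilon> (fst z)) (snd z)"
  let ?L = "\<lambda>z. ln (?W z / output_prob \<epsilon> P (snd z))"
  interpret J: prob_space ?J by (rule prob_space_poisson_joint[OF assms(1) P])
  have msnd[measurable]: "snd \<in> ?J \<rightarrow>\<^sub>M count_space UNIV"
    unfolding poisson_joint_def by simp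
  define G where "G y = (\<epsilon> / (1 + \<epsilon>)) ^ y / (1 + \<epsilon>)" for y :: nat
  have G: "G y > 0" for y using assms(1) by (simp add: G_def)
  have G_pmf: "G y = pmf (geometric_pmf (1 / (1 + \<epsilon>))) y" for y
    using assms(1) by (simp add: G_def field_simps)
  \<comment> \<open>This is affine in \<open>y\<close>, so its expectation depends on the output law
    only through the mean.\<close>
  have lnG: "- ln (G y) = ln (1 + \<epsilon>) + real y * (ln (1 + \<epsilon>) - ln \<epsilon>)" for y
    using assms(1) by (simp add: G_def ln_div ln_realpow algebra_simps)
  define u where "u y = G y / output_prob \<epsilon> P y" for y
  have Q0: "output_prob \<epsilon> P y \<ge> 0" for y by (simp add: output_prob_def)
  have u0: "u y \<ge> 0" for y using G[of y] Q0[of y] by (simp add: u_def)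
  have "(\<integral>\<^sup>+ z. ennreal (u (snd z)) \<partial>?J) =
      (\<integral>\<^sup>+ y. ennreal (u y) \<partial>distr ?J (count_space UNIV) snd)"
    by (subst nn_integral_distr) auto
  also have "\<dots> = (\<integral>\<^sup>+ y. ennreal (output_prob \<epsilon> P y * u y) \<partial>count_space UNIV)"
    unfolding distr_snd_poisson_joint[OF assms(1) P]
    using Q0 u0 by (subst nn_integral_density) (auto simp: ennreal_mult)
  \<comment> \<open>Only an inequality: where \<open>output_prob\<close> is 0, division by zero
    makes \<open>u y\<close> equal to 0 and the mass \<open>G y\<close> is lost.\<close>
  also have "\<dots> \<le> (\<integral>\<^sup>+ y. ennreal (G y) \<partial>count_space UNIV)"
    using G by (intro nn_integral_mono) (auto simp: u_def less_imp_le)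
  also have "\<dots> = 1"
    using nn_integral_pmf[of UNIV "geometric_pmf (1 / (1 + \<epsilon>))"]
      measure_pmf.emeasure_space_1[of "geometric_pmf (1 / (1 + \<epsilon>))"]
    by (simp add: G_pmf)
  finally have nu: "(\<integral>\<^sup>+ z. ennreal (u (snd z)) \<partial>?J) \<le> ennreal 1" by simp
  have int_u: "integrable ?J (\<lambda>z. u (snd z))"
    using u0 le_less_trans[OF nu] by (intro integrableI_nonneg) auto
  have Eu: "(\<integral>z. u (snd z) \<partial>?J) \<le> 1"
    using nu u0 int_u by (subst (asm) nn_integral_eq_integral) auto
  note ny = nn_integral_output_le[OF assms]
  have int_y: "integrable ?J (\<lambda>z. real (snd z))"
    using le_less_trans[OF ny] by (intro integrableI_nonneg) auto
  have Ey: "(\<integral>z. real (snd z) \<partial>?J) \<le> \<epsilon>"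
    using ny int_y assms(1) by (subst (asm) nn_integral_eq_integral) auto
  have ln0: "0 \<le> ln (1 + \<epsilon>) - ln \<epsilon>" "0 \<le> ln (1 + \<epsilon>)" using assms(1) by auto
  have ge0: "0 \<le> (1 + \<epsilon>) * ln (1 + \<epsilon>) - \<epsilon> * ln \<epsilon>"
  proof -
    have "(1 + \<epsilon>) * ln (1 + \<epsilon>) - \<epsilon> * ln \<epsilon> = ln (1 + \<epsilon>) + \<epsilon> * (ln (1 + \<epsilon>) - ln \<epsilon>)"
      by (simp add: algebra_simps)
    with ln0 assms(1) show ?thesis
      by (metis add_nonneg_nonneg less_imp_le mult_nonneg_nonneg)
  qed
  \<comment> \<open>If the log ratio is not integrable, its Bochner integral is 0, and
    \<open>ge0\<close> puts this below the bound.\<close>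
  show ?thesis
  proof (cases "integrable ?J ?L")
    case True
    have "AE z in ?J. ?L z \<le> ln (1 + \<epsilon>) + (ln (1 + \<epsilon>) - ln \<epsilon>) * real (snd z) + u (snd z) - 1"
      using AE_poisson_joint_pos[OF assms(1) P]
    proof eventually_elim
      case (elim z)
      let ?q = "output_prob \<epsilon> P (snd z)"
      have "?L z \<le> - ln ?q"
        using elim pmf_le_1[of "poisson_channel \<epsilon> (fst z)" "snd z"] by (simp add: ln_div)
      also have "\<dots> = - ln (G (snd z)) + ln (u (snd z))"
        using elim G[of "snd z"] by (simp add: u_def ln_div)
      also have "\<dots> \<le> - ln (G (snd z)) + (u (snd z) - 1)"
        using elim G[of "snd z"] by (intro add_left_mono ln_le_minus_one) (simp add: u_def)
      finally show ?case by (simp add: lnG algebra_simps)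
    qed
    then have "(\<integral>z. ?L z \<partial>?J) \<le>
        (\<integral>z. ln (1 + \<epsilon>) + (ln (1 + \<epsilon>) - ln \<epsilon>) * real (snd z) + u (snd z) - 1 \<partial>?J)"
      using True int_u int_y by (intro integral_mono_AE) auto
    also have "\<dots> = ln (1 + \<epsilon>) + (ln (1 + \<epsilon>) - ln \<epsilon>) * (\<integral>z. real (snd z) \<partial>?J) +
        (\<integral>z. u (snd z) \<partial>?J) - 1"
      using int_u int_y by (simp add: J.prob_space)
    \<comment> \<open>The coefficient of the mean output is nonnegative, so the mean may be replaced
      by \<open>\<epsilon>\<close>; the expectation of \<open>u\<close> is at most the 1 that is
      subtracted.\<close>
    also have "\<dots> \<le> ln (1 + \<epsilon>) + (ln (1 + \<epsilon>) - ln \<epsilon>) * \<epsilon> + 1 - 1"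
      using Eu Ey ln0 by (intro diff_right_mono add_mono mult_left_mono) auto
    finally show ?thesis
      by (simp add: poisson_mutual_information_eq_integral[OF assms(1) P] algebra_simps)
  next
    case False
    then show ?thesis
      using ge0 by (simp add: poisson_mutual_information_eq_integral[OF assms(1) P]
          not_integrable_integral_eq)
  qed
qed

section \<open>Lower bound by on-off keying\<close>

text \<open>The amplitude \<open>1 / p\<close> makes the mean input exactly 1, so the whole energy
  budget is spent.\<close>

definition on_off_input :: "real \<Rightarrow> real measure" where
  "on_off_input p = distr (measure_pmf (bernoulli_pmf p)) borel (\<lambda>b. if b then 1 / p else 0)"

lemma nn_integral_on_off_input:
  assumes "0 < p" "p \<le> 1" "f \<in> borel_measurable borel"
  shows "(\<integral>\<^sup>+ x. f x \<partial>on_off_input p) = f (1 / p) * ennreal p + f 0 * ennreal (1 - p)"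
  using assms by (simp add: on_off_input_def nn_integral_distr)

lemma prob_space_on_off_input: "prob_space (on_off_input p)"
  unfolding on_off_input_def by (rule measure_pmf.prob_space_distr) simp

lemma sets_on_off_input: "sets (on_off_input p) = sets borel"
  by (simp add: on_off_input_def)

lemma AE_on_off_input: "AE x in on_off_input p. x = 1 / p \<or> x = 0"
  unfolding on_off_input_def by (subst AE_distr_iff) auto

lemma on_off_input_in_poisson_inputs:
  assumes "0 < p" "p \<le> 1"
  shows "on_off_input p \<in> poisson_inputs"
proof -
  have "AE x in on_off_input p. 0 \<le> x"
    using AE_on_off_input[of p] assms by (auto elim!: eventually_mono)
  then show ?thesis
    using assms nn_integral_on_off_input[OF assms, of ennreal]
    by (simp add: poisson_inputs_def prob_space_on_off_input sets_on_off_input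
        flip: ennreal_mult)
qed

lemma measure_poisson_joint_on_off:
  assumes "\<epsilon> > 0" "0 < p" "p \<le> 1" "A \<in> sets borel"
  shows "measure (poisson_joint \<epsilon> (on_off_input p)) (A \<times> B) =
    p * indicator A (1 / p) * measure (measure_pmf (poisson_channel \<epsilon> (1 / p))) B +
    (1 - p) * indicator A 0 * indicator B 0"
proof -
  \<comment> \<open>Writing the integrand as an inner integral over outputs makes its measurability
    in \<open>x\<close> an instance of Tonelli.\<close>
  have eq: "emeasure (measure_pmf (poisson_channel \<epsilon> x)) B * indicator A x =
     (\<integral>\<^sup>+ y. ennreal (pmf (poisson_channel \<epsilon> x) y) * (indicator B y * indicator A x) \<partial>count_space UNIV)"
    for x
    by (simp flip: nn_integral_measure_pmf add: nn_integral_multc)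
  have m: "(\<lambda>x. emeasure (measure_pmf (poisson_channel \<epsilon> x)) B * indicator A x) \<in> borel_measurable borel"
  proof -
    interpret C: sigma_finite_measure "count_space (UNIV :: nat set)"
      by (rule sigma_finite_measure_count_space)
    note borel_measurable_pmf_poisson_channel[OF assms(1) refl, measurable] assms(4)[measurable]
    have "(\<lambda>x. \<integral>\<^sup>+ y. (\<lambda>z. ennreal (pmf (poisson_channel \<epsilon> (fst z)) (snd z)) *
        (indicator B (snd z) * indicator A (fst z))) (x, y) \<partial>count_space UNIV)
        \<in> borel_measurable borel"
      by (intro C.borel_measurable_nn_integral_fst) measurable
    then show ?thesis by (simp add: eq)
  qed
  have "emeasure (poisson_joint \<epsilon> (on_off_input p)) (A \<times> B) = ennreal (
    p * indicator A (1 / p) * measure (measure_pmf (poisson_channel \<epsilon> (1 / p))) B +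
    (1 - p) * indicator A 0 * indicator B 0)"
    using assms m
    by (subst emeasure_poisson_joint)
      (auto simp: prob_space_on_off_input sets_on_off_input nn_integral_on_off_input
       poisson_channel_def measure_pmf.emeasure_eq_measure indicator_def ennreal_mult' mult_ac
       simp flip: ennreal_mult' ennreal_plus)
  then show ?thesis
    using assms unfolding measure_def by (subst enn2real_ennreal[symmetric]) (auto simp: measure_def)
qed

text \<open>The factor \<open>1 - exp (- \<epsilon> / p)\<close> is the probability that a pulse,
  whose energy is \<open>\<epsilon> / p\<close>, yields a positive output.\<close>

lemma poisson_mutual_information_on_off_ge:
  assumes "\<epsilon> > 0" "0 < p" "p \<le> 1"
  shows "p * (1 - exp (- \<epsilon> / p)) * (- ln p) - \<epsilon> \<le> poisson_mutual_information \<epsilon> (on_off_input p)"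
proof -
  let ?P = "on_off_input p"
  let ?J = "poisson_joint \<epsilon> ?P" and ?W = "\<lambda>z. pmf (poisson_channel \<epsilon> (fst z)) (snd z)"
  let ?L = "\<lambda>z. ln (?W z / output_prob \<epsilon> ?P (snd z))"
  note P = prob_space_on_off_input[of p] sets_on_off_input[of p]
  interpret J: prob_space ?J by (rule prob_space_poisson_joint[OF assms(1) P])
  note sJ = sets_poisson_joint[OF P(2), of \<epsilon>]
  note [measurable_cong] = sJ
  note borel_measurable_pmf_poisson_channel[OF assms(1) refl, measurable]
  let ?q0 = "output_prob \<epsilon> ?P 0"
  \<comment> \<open>A nonzero output can only come from a pulse, so for a pulse the likelihood ratio
    at such an output is exactly \<open>1 / p\<close>.\<close>
  have Q: "output_prob \<epsilon> ?P y = p * pmf (poisson_channel \<epsilon> (1 / p)) y" if "y \<noteq> 0" for y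
    using assms that by (simp add: output_prob_def measure_poisson_joint_on_off measure_pmf_single)
  have q0: "?q0 \<le> 1" by (simp add: output_prob_def)
  \<comment> \<open>The almost sure values of the log ratio: no pulse, a pulse that goes unnoticed,
    a pulse that is detected. A nonzero output without a pulse is a null event.\<close>
  define L' where "L' z = (if fst z = 0 then - ln ?q0 else if snd z = 0 then - \<epsilon> / p - ln ?q0 else - ln p)"
    for z :: "real \<times> nat"
  have mfst: "fst \<in> ?J \<rightarrow>\<^sub>M ?P"
    unfolding measurable_cong_sets[OF sJ P(2)] by simp
  have "AE x in distr ?J ?P fst. x = 1 / p \<or> x = 0"
    unfolding distr_fst_poisson_joint[OF assms(1) P] by (rule AE_on_off_input)
  then have "AE z in ?J. fst z = 1 / p \<or> fst z = 0"
    by (rule AE_distrD[OF mfst])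
  then have LL': "AE z in ?J. ?L z = L' z"
    using AE_poisson_joint_pos[OF assms(1) P]
  proof eventually_elim
    case (elim z)
    consider "fst z = 0" "snd z = 0" | "fst z = 1 / p" "snd z = 0" | "fst z = 1 / p" "snd z \<noteq> 0"
      using elim by (cases "snd z") (auto simp: poisson_channel_def)
    then show ?case
    proof cases
      case 1
      then show ?thesis using elim by (simp add: L'_def poisson_channel_def ln_div)
    next
      case 2
      then show ?thesis using elim assms by (simp add: L'_def poisson_channel_def ln_div)
    next
      case 3
      then show ?thesis using elim assms Q[of "snd z"] by (simp add: L'_def ln_div)
    qed
  qed
  have mL': "L' \<in> borel_measurable ?J"
    unfolding L'_def by measurable
  have mL: "?L \<in> borel_measurable ?J" by measurable
  \<comment> \<open>Boundedness gives integrability, so here the Bochner integral is a genuine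
    expectation and can be bounded from below.\<close>
  have "norm (L' z) \<le> \<bar>\<epsilon> / p\<bar> + \<bar>ln ?q0\<bar> + \<bar>ln p\<bar>" for z
    unfolding L'_def real_norm_def minus_divide_left[symmetric] by (split if_split, split if_split) arith
  then have intL': "integrable ?J L'"
    by (intro J.integrable_const_bound mL' AE_I2)
  define A :: "real set" where "A = - {0}"
  have [measurable]: "A \<in> sets borel" by (simp add: A_def)
  have sets: "A \<times> {0} \<in> sets ?J" "A \<times> {1..} \<in> sets ?J" by (auto simp: sJ)
  \<comment> \<open>This is \<open>L'\<close> without its terms \<open>- ln ?q0\<close>, which are
    nonnegative because \<open>?q0\<close> is a probability.\<close>
  let ?l = "\<lambda>z. - (\<epsilon> / p) * indicator (A \<times> {0}) z - ln p * indicator (A \<times> {1..}) z :: real"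
  have "p * (1 - exp (- \<epsilon> / p)) * (- ln p) - \<epsilon> \<le>
      - (\<epsilon> / p) * measure ?J (A \<times> {0}) - ln p * measure ?J (A \<times> {1..})"
  proof -
    have m0: "measure ?J (A \<times> {0}) = p * exp (- \<epsilon> / p)"
      using assms by (simp add: measure_poisson_joint_on_off A_def measure_pmf_single poisson_channel_def)
    have c: "{1..} = space (measure_pmf (poisson_channel \<epsilon> (1 / p))) - {0::nat}" by auto
    have "measure (measure_pmf (poisson_channel \<epsilon> (1 / p))) {1..} = 1 - exp (- \<epsilon> / p)"
      unfolding c using assms
      by (subst measure_pmf.prob_compl) (auto simp: measure_pmf_single poisson_channel_def)
    then have m1: "measure ?J (A \<times> {1..}) = p * (1 - exp (- \<epsilon> / p))"
      using assms by (simp add: measure_poisson_joint_on_off A_def)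
    have "\<epsilon> * exp (- \<epsilon> / p) \<le> \<epsilon> * 1" using assms by (intro mult_left_mono) auto
    then show ?thesis unfolding m0 m1 using assms by (simp add: algebra_simps)
  qed
  also have "\<dots> = (\<integral>z. ?l z \<partial>?J)"
    using sets by (simp add: J.emeasure_eq_measure)
  also have "\<dots> \<le> (\<integral>z. L' z \<partial>?J)"
  proof (rule integral_mono)
    show "integrable ?J ?l"
      using sets by (intro Bochner_Integration.integrable_diff integrable_mult_right
        integrable_real_indicator) (auto simp: J.emeasure_eq_measure)
    have "ln ?q0 \<le> 0" using q0 by (cases "?q0 = 0") (auto simp: output_prob_def less_le)
    then show "?l z \<le> L' z" for z
      by (cases z) (auto simp: L'_def A_def indicator_def)
  qed (rule intL')
  also have "\<dots> = (\<integral>z. ?L z \<partial>?J)"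
    using LL' by (intro integral_cong_AE mL mL') auto
  finally show ?thesis
    by (simp add: poisson_mutual_information_eq_integral[OF assms(1) P])
qed

section \<open>Asymptotic comparison of the two bounds\<close>

theorem theorem1:
  shows "\<exists>r :: real \<Rightarrow> real.
    r \<in> o[at_right 0](\<lambda>\<epsilon>. - \<epsilon> * ln \<epsilon>) \<and>
    (\<forall>\<^sub>F \<epsilon> in at_right 0. poisson_capacity \<epsilon> = ereal (- \<epsilon> * ln \<epsilon> + r \<epsilon>))"
proof -
  define U where "U \<epsilon> = (1 + \<epsilon>) * ln (1 + \<epsilon>) - \<epsilon> * ln \<epsilon>" for \<epsilon> :: real
  \<comment> \<open>\<open>p \<epsilon>\<close> is both the pulse probability of the lower bound and
    the leading term of the expansion.\<close>
  define p where "p \<epsilon> = - \<epsilon> * ln \<epsilon>" for \<epsilon> :: real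
  define V where "V \<epsilon> = p \<epsilon> * (1 - exp (- \<epsilon> / p \<epsilon>)) * (- ln (p \<epsilon>)) - \<epsilon>" for \<epsilon> :: real
  \<comment> \<open>The conversion to a real is faithful near 0, where the capacity lies between the
    finite values \<open>V \<epsilon>\<close> and \<open>U \<epsilon>\<close>.\<close>
  define r where "r \<epsilon> = real_of_ereal (poisson_capacity \<epsilon>) - p \<epsilon>" for \<epsilon>
  have p: "\<forall>\<^sub>F \<epsilon> in at_right 0. 0 < p \<epsilon>" "\<forall>\<^sub>F \<epsilon> in at_right 0. p \<epsilon> \<le> 1"
    unfolding p_def by real_asymp+
  have pos: "\<forall>\<^sub>F \<epsilon> in at_right 0. (0::real) < \<epsilon>" by real_asymp
  have bounds: "\<forall>\<^sub>F \<epsilon> in at_right 0. poisson_capacity \<epsilon> = ereal (p \<epsilon> + r \<epsilon>) \<and>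
      V \<epsilon> - p \<epsilon> \<le> r \<epsilon> \<and> r \<epsilon> \<le> U \<epsilon> - p \<epsilon>"
    using p pos
  proof eventually_elim
    case (elim \<epsilon>)
    have "poisson_capacity \<epsilon> \<le> ereal (U \<epsilon>)"
      unfolding poisson_capacity_def
      by (rule SUP_least) (use elim in \<open>auto simp: U_def intro!: poisson_mutual_information_le\<close>)
    moreover have "ereal (V \<epsilon>) \<le> poisson_capacity \<epsilon>"
      unfolding poisson_capacity_def
      by (rule SUP_upper2[OF on_off_input_in_poisson_inputs[of "p \<epsilon>"]])
         (use elim poisson_mutual_information_on_off_ge[of \<epsilon> "p \<epsilon>"] in \<open>auto simp: V_def\<close>)
    ultimately show ?case
      by (cases "poisson_capacity \<epsilon>") (auto simp: r_def)
  qed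
  have lim: "((\<lambda>\<epsilon>. r \<epsilon> / (- \<epsilon> * ln \<epsilon>)) \<longlongrightarrow> 0) (at_right 0)"
  proof (rule tendsto_sandwich)
    \<comment> \<open>As \<open>\<epsilon> / p \<epsilon>\<close> tends to 0,
      \<open>p \<epsilon> * (1 - exp (- \<epsilon> / p \<epsilon>))\<close> is asymptotic to
      \<open>\<epsilon>\<close>. Moreover \<open>- ln (p \<epsilon>)\<close> is
      \<open>- ln \<epsilon>\<close> up to an iterated logarithm, so \<open>V \<epsilon>\<close> is
      asymptotic to \<open>p \<epsilon>\<close>.\<close>
    show "((\<lambda>\<epsilon>. (V \<epsilon> - p \<epsilon>) / (- \<epsilon> * ln \<epsilon>)) \<longlongrightarrow> 0) (at_right 0)"
      unfolding V_def p_def by real_asymp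
    \<comment> \<open>The numerator is \<open>(1 + \<epsilon>) * ln (1 + \<epsilon>)\<close>, of
      order \<open>\<epsilon>\<close>.\<close>
    show "((\<lambda>\<epsilon>. (U \<epsilon> - p \<epsilon>) / (- \<epsilon> * ln \<epsilon>)) \<longlongrightarrow> 0) (at_right 0)"
      unfolding U_def p_def by real_asymp
    show "\<forall>\<^sub>F \<epsilon> in at_right 0. (V \<epsilon> - p \<epsilon>) / (- \<epsilon> * ln \<epsilon>) \<le> r \<epsilon> / (- \<epsilon> * ln \<epsilon>)"
      using bounds p(1) by eventually_elim (rule divide_right_mono; simp add: p_def)
    show "\<forall>\<^sub>F \<epsilon> in at_right 0. r \<epsilon> / (- \<epsilon> * ln \<epsilon>) \<le> (U \<epsilon> - p \<epsilon>) / (- \<epsilon> * ln \<epsilon>)"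
      using bounds p(1) by eventually_elim (rule divide_right_mono; simp add: p_def)
  qed
  have "r \<in> o[at_right 0](\<lambda>\<epsilon>. - \<epsilon> * ln \<epsilon>)"
    by (rule smalloI_tendsto[OF lim]) (use p(1) in \<open>auto simp: p_def elim!: eventually_mono\<close>)
  moreover have "\<forall>\<^sub>F \<epsilon> in at_right 0. poisson_capacity \<epsilon> = ereal (- \<epsilon> * ln \<epsilon> + r \<epsilon>)"
    using bounds by (auto simp: p_def elim!: eventually_mono)
  ultimately show ?thesis by blast
qed

end
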